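(* Let $s\ge 0$ be an integer and let $Q_s(z)=\sum_{n\ge 2s+1}T_n^{(s)}(x)z^n$ be the generating function of the incomplete tribonacci polynomials $T_n^{(s)}(x)$, $n \geq 2s+1$. Then $$\frac{Q_s(z)}{z^{2s+1}}=\frac{T_{2s+1}(x)+\left(T_{2s-1}(x)+xT_{2s}(x)\right)z+T_{2s}(x)z^2-z^2\left(\frac{x+z}{1-x^2z}\right)^{s+1}}{1-x^2z-xz^2-z^3}.$$
   Context: The tribonacci polynomials $T_n(x)$ are defined by $T_0(x)=0$, $T_1(x)=1$, $T_2(x)=x^2$ and $T_n(x)=x^2T_{n-1}(x)+xT_{n-2}(x)+T_{n-3}(x)$ for $n\ge 3$; also $T_{-1}(x)=0$. For integers $n\ge 0$ and $0\le s\le \lfloor n/2\rfloor$, the incomplete tribonacci polynomial is defined by $$T_{n+1}^{(s)}(x)=\sum_{i=0}^{s}\sum_{j=0}^i \binom{i}{j}\binom{n-i-j}{i}x^{2n-3(i+j)}.$$ The identity is one of formal power series in $z$ with coefficients polynomials in $x$. *)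

theory Defs
  imports "HOL-Computational_Algebra.Computational_Algebra"
begin

text \<open>Polynomials in \<open>x\<close> are elements of \<^typ>\<open>int poly\<close>; the variable \<open>x\<close> is \<open>[:0, 1:]\<close>.\<close>

abbreviation xvar :: "int poly" where
  "xvar \<equiv> [:0, 1:]"

fun trib_nat :: "nat \<Rightarrow> int poly" where
  "trib_nat 0 = 0"
| "trib_nat (Suc 0) = 1"
| "trib_nat (Suc (Suc 0)) = xvar ^ 2"
| "trib_nat (Suc (Suc (Suc n))) =
     xvar ^ 2 * trib_nat (Suc (Suc n)) + xvar * trib_nat (Suc n) + trib_nat n"

text \<open>Integer indices provide for \<open>T\<^sub>-\<^sub>1 = 0\<close>; no index below \<open>-1\<close> is ever used.\<close>

definition trib :: "int \<Rightarrow> int poly" where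
  "trib n = (if n < 0 then 0 else trib_nat (nat n))"

text \<open>
  \<open>inc_trib s m\<close> is the incomplete tribonacci polynomial with upper index \<open>s\<close> and lower
  index \<open>m = n + 1\<close>. It is meaningful for \<open>m \<ge> 1\<close> and \<open>s \<le> (m - 1) div 2\<close>, that is
  \<open>m \<ge> 2 * s + 1\<close>. In that range \<open>n - i - j\<close> is not truncated; \<open>2 * n - 3 * (i + j)\<close> is
  truncated only if \<open>n < 2 * i + j\<close>, and then the binomial coefficient in front vanishes.
\<close>

definition inc_trib :: "nat \<Rightarrow> nat \<Rightarrow> int poly" where
  "inc_trib s m = (let n = m - 1 in
     \<Sum>i=0..s. \<Sum>j=0..i.
       of_nat ((i choose j) * ((n - i - j) choose i)) * xvar ^ (2 * n - 3 * (i + j)))"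

definition Q :: "nat \<Rightarrow> int poly fps" where
  "Q s = Abs_fps (\<lambda>n. if n \<ge> 2 * s + 1 then inc_trib s n else 0)"

text \<open>
  Library division of power series needs a coefficient type with an inverse operation, so
  quotients are taken over the fraction field of \<^typ>\<open>int poly\<close>, into which its power
  series embed injectively, coefficient by coefficient.
\<close>

definition fract_fps :: "int poly fps \<Rightarrow> int poly fract fps" where
  "fract_fps F = Abs_fps (\<lambda>n. to_fract (fps_nth F n))"

end

theory Submission
  imports Defs
begin

text \<open>
  For fixed \<open>i\<close> the summands of the incomplete tribonacci polynomials have a closed generating
  function: substituting \<open>n = m + 2 * i + j\<close> separates the negative binomial series
  \<open>(\<Sum>m. ((m + i) choose i) * (x\<^sup>2 * z) ^ m) = 1 / (1 - x\<^sup>2 * z) ^ (i + 1)\<close> from the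
  binomial sum \<open>(\<Sum>j\<le>i. (i choose j) * x ^ (i - j) * z ^ j) = (x + z) ^ i\<close>, so the contribution
  of \<open>i\<close> is \<open>w ^ i / (1 - x\<^sup>2 * z)\<close> with \<open>w = z\<^sup>2 * (x + z) / (1 - x\<^sup>2 * z)\<close>
  (lemma \<open>layer_gf\<close>). Since the tribonacci denominator \<open>D = 1 - x\<^sup>2 * z - x * z\<^sup>2 - z\<^sup>3\<close> equals
  \<open>(1 - x\<^sup>2 * z) * (1 - w)\<close>, the geometric sum over \<open>i \<le> s\<close> is \<open>(1 - w ^ (s + 1)) / D\<close>.

  Restricting to lower indices at least \<open>2 * s + 1\<close> and dividing by \<open>z ^ (2 * s + 1)\<close> amounts to
  deleting the first \<open>2 * s\<close> coefficients of this series. The power \<open>w ^ (s + 1)\<close> is divisible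
  by \<open>z ^ (2 * s + 2)\<close>, so the shift only lowers its power of \<open>z\<close> to \<open>z\<^sup>2\<close>, while \<open>1 / D\<close> is
  the generating function of the tribonacci polynomials, whose tails have a quadratic numerator
  by the recurrence (lemma \<open>trib_tail_gf\<close>).

  The computation takes place over \<^typ>\<open>int poly\<close>, where \<open>1 / (1 - x\<^sup>2 * z)\<close> is
  represented by the geometric series. Only the resulting identity is carried over to the
  fraction field, and there the division is cancelled.
\<close>

section \<open>Geometric series and its powers\<close>

definition geo_fps :: "'a::comm_ring_1 \<Rightarrow> 'a fps" where
  "geo_fps a = Abs_fps (\<lambda>n. a ^ n)"

lemma nth_fps_const_X_mult:
  fixes a :: "'a::comm_ring_1"
  shows "fps_nth (fps_const a * fps_X * f) n = (if n = 0 then 0 else a * fps_nth f (n - 1))"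
  by (simp add: mult.assoc)

lemma one_minus_mult_geo_fps: "(1 - fps_const a * fps_X) * geo_fps a = 1"
proof (rule fps_ext)
  fix n
  show "fps_nth ((1 - fps_const a * fps_X) * geo_fps a) n = fps_nth 1 n"
    unfolding left_diff_distrib fps_sub_nth nth_fps_const_X_mult
    by (cases n) (simp_all add: geo_fps_def)
qed

text \<open>
  Multiplying by \<open>1 - a * z\<close> turns the coefficient \<open>(n + Suc i) choose Suc i\<close> into
  \<open>(n + i) choose i\<close> by Pascal's rule, which is the induction step.
\<close>

lemma geo_fps_power:
  "geo_fps a ^ Suc i = Abs_fps (\<lambda>n. of_nat ((n + i) choose i) * a ^ n)"
proof (induction i)
  case 0
  show ?case by (simp add: geo_fps_def)
next
  case (Suc i)
  define B where "B k = Abs_fps (\<lambda>n. of_nat ((n + k) choose k) * a ^ n)" for k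
  have "(1 - fps_const a * fps_X) * B (Suc i) = B i"
  proof (rule fps_ext)
    fix n
    show "fps_nth ((1 - fps_const a * fps_X) * B (Suc i)) n = fps_nth (B i) n"
      unfolding left_diff_distrib fps_sub_nth nth_fps_const_X_mult
      by (cases n) (simp_all add: B_def algebra_simps binomial_eq_0)
  qed
  then have "geo_fps a * B i = ((1 - fps_const a * fps_X) * geo_fps a) * B (Suc i)"
    by (metis mult.assoc mult.commute)
  then have "geo_fps a * B i = B (Suc i)"
    by (simp add: one_minus_mult_geo_fps)
  then show ?case
    using Suc.IH by (simp add: B_def)
qed

section \<open>Generating functions over the polynomial ring\<close>

abbreviation xc :: "int poly fps" where
  "xc \<equiv> fps_const xvar"

abbreviation trib_denom :: "int poly fps" where
  "trib_denom \<equiv> 1 - xc ^ 2 * fps_X - xc * fps_X ^ 2 - fps_X ^ 3"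

text \<open>The inner sum of the incomplete tribonacci polynomial with lower index \<open>n + 1\<close>.\<close>

definition layer :: "nat \<Rightarrow> nat \<Rightarrow> int poly" where
  "layer i n = (\<Sum>j=0..i.
     of_nat ((i choose j) * ((n - i - j) choose i)) * xvar ^ (2 * n - 3 * (i + j)))"

text \<open>
  The binomial coefficient vanishes for \<open>n < 2 * i + j\<close>, including the cases in which
  \<open>n - i - j\<close> is truncated; for \<open>n = m + 2 * i + j\<close> the exponent of \<open>x\<close> is \<open>2 * m + (i - j)\<close>.
\<close>

lemma layer_summand_gf:
  assumes "j \<le> i"
  shows "Abs_fps (\<lambda>n. of_nat ((i choose j) * ((n - i - j) choose i)) * xvar ^ (2 * n - 3 * (i + j)))
    = of_nat (i choose j) * fps_X ^ j * xc ^ (i - j)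
        * (fps_X ^ (2 * i) * geo_fps (xvar ^ 2) ^ Suc i)" (is "?L = ?R")
proof (rule fps_ext)
  fix n
  have shift: "?R = fps_X ^ (2 * i + j) * (fps_const (of_nat (i choose j) * xvar ^ (i - j))
      * geo_fps (xvar ^ 2) ^ Suc i)"
    by (simp only: power_add fps_of_nat fps_const_power fps_const_mult [symmetric] ac_simps)
  have R: "fps_nth ?R n = (if n < 2 * i + j then 0 else of_nat (i choose j) * xvar ^ (i - j)
      * (of_nat ((n - (2 * i + j) + i) choose i) * (xvar ^ 2) ^ (n - (2 * i + j))))"
    unfolding shift unfolding fps_X_power_mult_nth geo_fps_power by simp
  show "fps_nth ?L n = fps_nth ?R n"
  proof (cases "n < 2 * i + j")
    case True
    then have "(n - i - j) choose i = 0 \<or> i = 0"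
      by (intro disjCI binomial_eq_0) linarith
    with True assms R show ?thesis by auto
  next
    case False
    then obtain m where n: "n = 2 * i + j + m"
      using le_Suc_ex not_less by blast
    from assms obtain d where d: "i = j + d"
      using le_Suc_ex by blast
    have e: "n - i - j = m + i" "2 * n - 3 * (i + j) = d + 2 * m" "i - j = d" "n - (2 * i + j) = m"
      using n d by simp_all
    then have "fps_nth ?L n = of_nat ((i choose j) * ((m + i) choose i)) * xvar ^ (d + 2 * m)"
      by (simp only: fps_nth_Abs_fps)
    also have "\<dots> = fps_nth ?R n"
      unfolding R unfolding e using False by (simp add: power_add power_mult)
    finally show ?thesis .
  qed
qed

lemma layer_gf:
  "Abs_fps (layer i) = geo_fps (xvar ^ 2) * (fps_X ^ 2 * ((xc + fps_X) * geo_fps (xvar ^ 2))) ^ i"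
proof -
  have "Abs_fps (layer i) = (\<Sum>j=0..i. Abs_fps (\<lambda>n.
      of_nat ((i choose j) * ((n - i - j) choose i)) * xvar ^ (2 * n - 3 * (i + j))))"
    by (rule fps_ext) (simp add: layer_def fps_sum_nth)
  also have "\<dots> = (\<Sum>j\<le>i. of_nat (i choose j) * fps_X ^ j * xc ^ (i - j)
      * (fps_X ^ (2 * i) * geo_fps (xvar ^ 2) ^ Suc i))"
    unfolding atLeast0AtMost by (intro sum.cong refl layer_summand_gf) simp
  also have "\<dots> = (fps_X + xc) ^ i * (fps_X ^ (2 * i) * geo_fps (xvar ^ 2) ^ Suc i)"
    unfolding binomial_ring by (rule sum_distrib_right [symmetric])
  finally show ?thesis
    unfolding power_mult_distrib power_mult power_Suc by (simp only: ac_simps)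
qed

text \<open>
  Coefficients from \<open>z\<^sup>3\<close> on cancel by the recurrence; in the three lower ones the recurrence
  reaches back before the tail, which leaves the terms in \<open>T\<^sub>k\<close> and \<open>T\<^sub>k\<^sub>-\<^sub>1\<close>. The convention
  \<open>T\<^sub>-\<^sub>1 = 0\<close> makes this uniform in \<open>k\<close>: for \<open>k = 0\<close> the numerator is \<open>1\<close>.
\<close>

lemma trib_tail_gf:
  "trib_denom * Abs_fps (\<lambda>n. trib_nat (n + k + 1)) =
     fps_const (trib (int k + 1)) + (fps_const (trib (int k - 1)) + xc * fps_const (trib (int k))) * fps_X
       + fps_const (trib (int k)) * fps_X ^ 2" (is "_ * ?F = ?R")
proof (rule fps_ext)
  fix n :: nat
  have D: "trib_denom * ?F = ?F - fps_const (xvar ^ 2) * (fps_X * ?F)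
      - xc * (fps_X ^ 2 * ?F) - fps_X ^ 3 * ?F"
    by (simp add: algebra_simps fps_const_power)
  have R: "?R = fps_const (trib (int k + 1))
      + fps_const (trib (int k - 1) + xvar * trib (int k)) * fps_X
      + fps_const (trib (int k)) * fps_X ^ 2"
    by (simp flip: fps_const_mult fps_const_add)
  have trib: "trib (int k + 1) = trib_nat (Suc k)" "trib (int k) = trib_nat k"
    by (simp_all add: trib_def nat_add_distrib)
  have trib': "trib_nat (Suc (Suc k)) =
      xvar ^ 2 * trib_nat (Suc k) + xvar * trib_nat k + trib (int k - 1)"
    by (cases k) (simp_all add: trib_def)
  consider "n = 0" | "n = 1" | "n = 2" | m where "n = m + 3"
    by atomize_elim presburger
  then show "fps_nth (trib_denom * ?F) n = fps_nth ?R n"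
  proof cases
    case 4
    have "trib_nat (m + 3 + k + 1) = xvar ^ 2 * trib_nat (m + 2 + k + 1)
        + xvar * trib_nat (m + 1 + k + 1) + trib_nat (m + k + 1)"
      using trib_nat.simps(4) [of "m + k + 1"] by (simp add: eval_nat_numeral)
    with 4 show ?thesis unfolding D R
      by (simp add: fps_X_power_mult_nth del: trib_nat.simps)
  next
    case 3
    have "trib_nat (2 + k + 1) = xvar ^ 2 * trib_nat (1 + k + 1)
        + xvar * trib_nat (0 + k + 1) + trib_nat k"
      by simp
    with 3 trib trib' show ?thesis unfolding D R
      by (simp add: fps_X_power_mult_nth del: trib_nat.simps)
  qed (use trib trib' in \<open>simp_all add: D R fps_X_power_mult_nth del: trib_nat.simps\<close>)
qed

text \<open>
  The defining double sum is used for every lower index, also below \<open>2 * s + 1\<close>, so that the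
  series is a finite sum of layers.
\<close>

definition inc_gf :: "nat \<Rightarrow> int poly fps" where
  "inc_gf s = Abs_fps (\<lambda>n. inc_trib s (n + 1))"

lemma Q_eq_shift: "Q s = fps_X ^ (2 * s + 1) * fps_shift (2 * s) (inc_gf s)"
proof (rule fps_ext)
  fix n
  show "fps_nth (Q s) n = fps_nth (fps_X ^ (2 * s + 1) * fps_shift (2 * s) (inc_gf s)) n"
    unfolding fps_X_power_mult_nth by (auto simp: Q_def inc_gf_def Suc_diff_Suc)
qed

text \<open>
  The layers form a geometric progression with ratio \<open>w\<close>, and the tribonacci denominator
  contains the factor \<open>1 - w\<close> that makes it telescope.
\<close>

lemma inc_gf_closed_form:
  "trib_denom * inc_gf s =
     1 - (fps_X ^ 2 * ((xc + fps_X) * geo_fps (xvar ^ 2))) ^ (s + 1)"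
proof -
  let ?G = "geo_fps (xvar ^ 2)"
  let ?W = "fps_X ^ 2 * ((xc + fps_X) * ?G)"
  have unit: "(1 - xc ^ 2 * fps_X) * ?G = 1"
    using one_minus_mult_geo_fps [of "xvar ^ 2"] by (simp add: fps_const_power)
  have "inc_gf s = (\<Sum>i=0..s. Abs_fps (layer i))"
    by (rule fps_ext) (simp add: inc_gf_def inc_trib_def layer_def fps_sum_nth)
  then have S: "inc_gf s = ?G * (\<Sum>i<Suc s. ?W ^ i)"
    by (simp only: layer_gf sum_distrib_left atLeast0AtMost lessThan_Suc_atMost)
  have "trib_denom * ?G = (1 - xc ^ 2 * fps_X) * ?G - ?W"
    by (simp add: algebra_simps power2_eq_square power3_eq_cube)
  then have "trib_denom * ?G = 1 - ?W"
    by (simp only: unit)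
  then have "trib_denom * inc_gf s = (1 - ?W) * (\<Sum>i<Suc s. ?W ^ i)"
    unfolding S by (simp only: mult.assoc [symmetric])
  then show ?thesis
    by (simp only: one_diff_power_eq Suc_eq_plus1)
qed

text \<open>
  With \<open>F = 1 / D\<close> the closed form reads \<open>F - w ^ (s + 1) * F\<close>, and
  \<open>w ^ (s + 1) = z ^ (2 * s) * (z\<^sup>2 * ((x + z) / (1 - x\<^sup>2 * z)) ^ (s + 1))\<close>: the shift turns \<open>F\<close>
  into a tribonacci tail and merely removes the factor \<open>z ^ (2 * s)\<close> from the second term.
\<close>

lemma shifted_inc_gf:
  "trib_denom * fps_shift (2 * s) (inc_gf s) =
     fps_const (trib (2 * int s + 1))
       + (fps_const (trib (2 * int s - 1)) + xc * fps_const (trib (2 * int s))) * fps_X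
       + fps_const (trib (2 * int s)) * fps_X ^ 2
       - fps_X ^ 2 * ((xc + fps_X) * geo_fps (xvar ^ 2)) ^ (s + 1)"
proof -
  let ?V = "(xc + fps_X) * geo_fps (xvar ^ 2)"
  define F where "F = Abs_fps (\<lambda>n. trib_nat (n + 1))"
  have F: "trib_denom * F = 1"
    using trib_tail_gf [of 0] by (simp add: F_def trib_def)
  have "inc_gf s = (trib_denom * F) * inc_gf s"
    by (simp only: F mult_1_left)
  also have "\<dots> = F * (1 - (fps_X ^ 2 * ?V) ^ (s + 1))"
    unfolding inc_gf_closed_form [symmetric]
    by (subst mult.commute [of trib_denom F]) (rule mult.assoc)
  also have "\<dots> = F - (fps_X ^ 2 * ?V ^ (s + 1) * F) * fps_X ^ (2 * s)"
  proof -
    have "(fps_X ^ 2 * ?V) ^ (s + 1) = fps_X ^ 2 * ?V ^ (s + 1) * fps_X ^ (2 * s)"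
      unfolding power_mult_distrib [of "fps_X ^ 2"] power_mult [symmetric]
        distrib_left power_add mult_1_right by (simp only: ac_simps)
    then show ?thesis
      by (simp only: right_diff_distrib mult_1_right ac_simps)
  qed
  finally have "fps_shift (2 * s) (inc_gf s) =
      fps_shift (2 * s) F - fps_X ^ 2 * ?V ^ (s + 1) * F"
    by (simp only: fps_shift_diff fps_shift_times_fps_X_power')
  then have "trib_denom * fps_shift (2 * s) (inc_gf s) =
      trib_denom * fps_shift (2 * s) F - fps_X ^ 2 * ?V ^ (s + 1) * (trib_denom * F)"
    by (simp only: right_diff_distrib [of trib_denom] mult.left_commute [of trib_denom])
  moreover have "fps_shift (2 * s) F = Abs_fps (\<lambda>n. trib_nat (n + 2 * s + 1))"
    by (rule fps_ext) (simp add: F_def)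
  ultimately show ?thesis
    using trib_tail_gf [of "2 * s"] by (simp only: F mult_1_right of_nat_mult of_nat_numeral)
qed

section \<open>Passage to the fraction field\<close>

lemma fract_fps_add: "fract_fps (f + g) = fract_fps f + fract_fps g"
  and fract_fps_diff: "fract_fps (f - g) = fract_fps f - fract_fps g"
  and fract_fps_mult: "fract_fps (f * g) = fract_fps f * fract_fps g"
  and fract_fps_1: "fract_fps 1 = 1"
  and fract_fps_X: "fract_fps fps_X = fps_X"
  by (simp_all add: fract_fps_def fps_eq_iff fps_mult_nth fps_one_nth fps_X_def)

lemma fract_fps_power: "fract_fps (f ^ n) = fract_fps f ^ n"
  by (induction n) (simp_all add: fract_fps_1 fract_fps_mult)

lemmas fract_fps_hom =
  fract_fps_add fract_fps_diff fract_fps_mult fract_fps_1 fract_fps_X fract_fps_power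

theorem theorem4p1:
  fixes s :: nat
  defines "T \<equiv> \<lambda>n :: int. fract_fps (fps_const (trib n))"
    and "x \<equiv> fract_fps (fps_const xvar)"
    and "z \<equiv> fps_X :: int poly fract fps"
  shows "fract_fps (Q s) / z ^ (2 * s + 1) =
    (T (2 * int s + 1) + (T (2 * int s - 1) + x * T (2 * int s)) * z + T (2 * int s) * z ^ 2
       - z ^ 2 * ((x + z) / (1 - x ^ 2 * z)) ^ (s + 1))
    / (1 - x ^ 2 * z - x * z ^ 2 - z ^ 3)"
proof -
  define G where "G = fract_fps (geo_fps (xvar ^ 2))"
  define P where "P = fract_fps (fps_shift (2 * s) (inc_gf s))"
  let ?E = "1 - x ^ 2 * z" and ?D = "1 - x ^ 2 * z - x * z ^ 2 - z ^ 3"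
  have "fps_nth ?E 0 = 1" "fps_nth ?D 0 = 1"
    by (simp_all add: z_def)
  then have nz: "?E \<noteq> 0" "?D \<noteq> 0"
    by (metis fps_zero_nth zero_neq_one)+
  have "(1 - xc ^ 2 * fps_X) * geo_fps (xvar ^ 2) = 1"
    using one_minus_mult_geo_fps [of "xvar ^ 2"] by (simp add: fps_const_power)
  from arg_cong [OF this, of fract_fps] have "?E * G = 1"
    by (simp only: fract_fps_hom G_def x_def z_def)
  then have "x + z = ?E * ((x + z) * G)"
    by (metis mult.left_commute mult.right_neutral)
  then have quot: "(x + z) / ?E = (x + z) * G"
    using nz(1) by (metis nonzero_mult_div_cancel_left)
  have "?D * P = T (2 * int s + 1) + (T (2 * int s - 1) + x * T (2 * int s)) * z
      + T (2 * int s) * z ^ 2 - z ^ 2 * ((x + z) * G) ^ (s + 1)"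
    using arg_cong [OF shifted_inc_gf [of s], of fract_fps]
    by (simp only: fract_fps_hom G_def P_def T_def x_def z_def)
  then have "P = (T (2 * int s + 1) + (T (2 * int s - 1) + x * T (2 * int s)) * z
      + T (2 * int s) * z ^ 2 - z ^ 2 * ((x + z) / ?E) ^ (s + 1)) / ?D"
    unfolding quot using nz(2) by (metis nonzero_mult_div_cancel_left)
  moreover have "fract_fps (Q s) / z ^ (2 * s + 1) = P"
  proof -
    have "fract_fps (Q s) = z ^ (2 * s + 1) * P"
      by (simp only: Q_eq_shift fract_fps_hom P_def z_def)
    moreover have "z ^ (2 * s + 1) \<noteq> 0"
      by (simp add: z_def)
    ultimately show ?thesis
      by (metis nonzero_mult_div_cancel_left)
  qed
  ultimately show ?thesis
    by simp
qed

end
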